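(* Let $\mathcal{F}\subseteq\mathcal{S}$ be a family of Catalan--Stanley trees with bivariate generating function $f(z,t)$, where $t$ marks the rightmost leaves of the branches attached to the root and $z$ marks all other nodes. Then the generating function (in the same sense) of $\rho^{-1}(\mathcal{F})=\{\tau\in\mathcal{S} : \rho(\tau)\in\mathcal{F}\}$ is \[ \Phi(f(z,t)) = \frac{1}{1-t}\, f\Big(z, \frac{t}{1-t}\,T(z)^{2}\Big), \] where $T(z)=\frac{1-\sqrt{1-4z}}{2}$.
   Context: A rooted plane tree has ordered children at every node. For each child $c$ of the root, the rightmost leaf of the branch at $c$ is the leaf reached from $c$ by repeatedly moving to the rightmost child. A Catalan--Stanley tree is a rooted plane tree in which every such rightmost leaf has odd distance to the root (the one-node tree is included); $\mathcal{S}$ is the class of these trees. The reduction $\rho:\mathcal{S}\to\mathcal{S}$ acts on a tree $\tau$ as follows: for each rightmost leaf $\ell$ of a branch attached to the root, if $\ell$ is a child of the root then $\ell$ is deleted; otherwise all descendants of the grandparent $g$ of $\ell$ are deleted, so that $g$ becomes a leaf (and is now the rightmost leaf of its branch). The one-node tree is mapped to itself. The bivariate generating function of a family $\mathcal{F}\subseteq\mathcal{S}$ is $\sum_{\tau\in\mathcal{F}} z^{a(\tau)}t^{b(\tau)}$, where $b(\tau)$ is the number of rightmost leaves of branches attached to the root (= number of children of the root) and $a(\tau)$ is the number of remaining nodes. $T(z)$ is the generating function of rooted plane trees by number of nodes, satisfying $T=z+T^2$. *)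

theory Defs
  imports Complex_Main "HOL-Computational_Algebra.Formal_Power_Series"
begin

datatype plane_tree = Node (children: "plane_tree list")

fun num_nodes :: "plane_tree \<Rightarrow> nat" where
  "num_nodes (Node ts) = Suc (\<Sum>c\<leftarrow>ts. num_nodes c)"

text \<open>Distance from the root of a tree to the leaf reached by repeatedly moving to the
  rightmost child.\<close>

function rightmost_depth :: "plane_tree \<Rightarrow> nat" where
  "rightmost_depth (Node ts) = (if ts = [] then 0 else Suc (rightmost_depth (last ts)))"
  by pat_completeness auto
termination
proof (relation "measure size")
  fix ts :: "plane_tree list"
  assume "ts \<noteq> []"
  then have "size (last ts) \<le> size_list size ts"
    by (intro size_list_estimation'[of "last ts"]) auto
  then show "(last ts, Node ts) \<in> measure size" by simp
qed simp

text \<open>The rightmost leaf of the branch at a child \<open>c\<close> of the root has distance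
  \<open>1 + rightmost_depth c\<close> to the root.\<close>

definition catalan_stanley :: "plane_tree set" where
  "catalan_stanley = {\<tau>. \<forall>c \<in> set (children \<tau>). odd (1 + rightmost_depth c)}"

text \<open>The grandparent of the rightmost leaf is the node on the rightmost path at which
  \<open>rightmost_depth\<close> equals 2. Trees of smaller \<open>rightmost_depth\<close> contain no such grandparent
  and are returned unchanged; for branches of Catalan--Stanley trees this happens only when the
  branch is a single leaf, and that case is handled separately in \<open>reduction\<close>.\<close>

function cut_at_grandparent :: "plane_tree \<Rightarrow> plane_tree" where
  "cut_at_grandparent (Node ts) =
     (if rightmost_depth (Node ts) < 2 then Node ts
      else if rightmost_depth (Node ts) = 2 then Node []
      else Node (butlast ts @ [cut_at_grandparent (last ts)]))"
  by pat_completeness auto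
termination
proof (relation "measure rightmost_depth")
  fix ts
  assume "\<not> rightmost_depth (Node ts) < 2" "rightmost_depth (Node ts) \<noteq> 2"
  then show "(last ts, Node ts) \<in> measure rightmost_depth"
    by (cases "ts = []") auto
qed simp

definition reduction :: "plane_tree \<Rightarrow> plane_tree" where
  "reduction \<tau> = Node (map cut_at_grandparent (filter (\<lambda>c. c \<noteq> Node []) (children \<tau>)))"

text \<open>Every child of the root contributes exactly one rightmost leaf, so the first function below
  counts the rightmost leaves of the branches.\<close>

definition num_rightmost_leaves :: "plane_tree \<Rightarrow> nat" where
  "num_rightmost_leaves \<tau> = length (children \<tau>)"

definition num_other_nodes :: "plane_tree \<Rightarrow> nat" where
  "num_other_nodes \<tau> = num_nodes \<tau> - num_rightmost_leaves \<tau>"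

text \<open>Bivariate formal power series in \<open>z\<close> and \<open>t\<close> are series in \<open>t\<close> (the outer variable) whose
  coefficients are series in \<open>z\<close> (the inner variable).\<close>

definition bivariate_gf :: "plane_tree set \<Rightarrow> real fps fps" where
  "bivariate_gf F = Abs_fps (\<lambda>b. Abs_fps (\<lambda>a.
     of_nat (card {\<tau> \<in> F. num_other_nodes \<tau> = a \<and> num_rightmost_leaves \<tau> = b})))"

definition plane_tree_gf :: "real fps" where
  "plane_tree_gf = Abs_fps (\<lambda>n. of_nat (card {\<tau>. num_nodes \<tau> = n}))"

text \<open>The operator \<open>f(z,t) \<mapsto> 1/(1-t) f(z, t/(1-t) T(z)\<^sup>2)\<close>. Here \<open>fps_X\<close> is the outer
  variable \<open>t\<close>, series in \<open>z\<close> alone are embedded by \<open>fps_const\<close>, and composition substitutes for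
  \<open>t\<close> only.\<close>

definition expansion :: "real fps \<Rightarrow> real fps fps \<Rightarrow> real fps fps" where
  "expansion T f = 1 / (1 - fps_X) * (f oo (fps_X / (1 - fps_X) * fps_const (T\<^sup>2)))"

text \<open>The cardinalities above are those of finite sets, the reduction preserves the class, and
  division by \<open>1 - t\<close> is an actual inverse although the coefficient ring is not a field.\<close>

lemma num_nodes_pos: "num_nodes \<tau> > 0"
  by (cases \<tau>) simp

lemma length_le_sum_num_nodes: "length ts \<le> (\<Sum>c\<leftarrow>ts. num_nodes c)"
proof (induction ts)
  case (Cons c ts)
  then show ?case using num_nodes_pos[of c] by simp
qed simp

lemma num_nodes_split: "num_nodes \<tau> = num_other_nodes \<tau> + num_rightmost_leaves \<tau>"
  using length_le_sum_num_nodes[of "children \<tau>"]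
  by (cases \<tau>) (simp add: num_other_nodes_def num_rightmost_leaves_def)

lemma finite_num_nodes_le: "finite {\<tau>. num_nodes \<tau> \<le> n}"
proof (induction n)
  case 0
  have "{\<tau>. num_nodes \<tau> \<le> 0} = {}" using num_nodes_pos by auto
  then show ?case by (metis finite.emptyI)
next
  case (Suc n)
  have "{\<tau>. num_nodes \<tau> \<le> Suc n} \<subseteq>
        Node ` {ts. set ts \<subseteq> {\<tau>. num_nodes \<tau> \<le> n} \<and> length ts \<le> n}"
  proof
    fix \<tau> assume "\<tau> \<in> {\<tau>. num_nodes \<tau> \<le> Suc n}"
    moreover obtain ts where \<tau>: "\<tau> = Node ts" by (cases \<tau>)
    ultimately have s: "(\<Sum>c\<leftarrow>ts. num_nodes c) \<le> n" by simp
    have "num_nodes c \<le> n" if "c \<in> set ts" for c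
      using member_le_sum_list[of "num_nodes c" "map num_nodes ts"] that s by simp
    moreover have "length ts \<le> n"
      using length_le_sum_num_nodes[of ts] s by simp
    ultimately show "\<tau> \<in> Node ` {ts. set ts \<subseteq> {\<tau>. num_nodes \<tau> \<le> n} \<and> length ts \<le> n}"
      using \<tau> by auto
  qed
  then show ?case
    using finite_lists_length_le[OF Suc.IH] by (meson finite_imageI finite_subset)
qed

lemma finite_num_nodes_eq: "finite {\<tau>. num_nodes \<tau> = n}"
  by (rule finite_subset[OF _ finite_num_nodes_le[of n]]) auto

lemma finite_bivariate_class:
  "finite {\<tau> \<in> F. num_other_nodes \<tau> = a \<and> num_rightmost_leaves \<tau> = b}"
  by (rule finite_subset[OF _ finite_num_nodes_le[of "a + b"]]) (auto simp: num_nodes_split)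

lemma rightmost_depth_cut_at_grandparent:
  "2 \<le> rightmost_depth c \<Longrightarrow> rightmost_depth (cut_at_grandparent c) = rightmost_depth c - 2"
proof (induction c rule: cut_at_grandparent.induct)
  case (1 ts)
  show ?case
  proof (cases "rightmost_depth (Node ts) = 2")
    case False
    then have ts: "ts \<noteq> []" and d: "3 \<le> rightmost_depth (Node ts)" using 1(2) by auto
    then have "rightmost_depth (cut_at_grandparent (last ts)) = rightmost_depth (last ts) - 2"
      using 1 False by simp
    then show ?thesis using ts d by simp
  qed simp
qed

lemma reduction_catalan_stanley:
  assumes "\<tau> \<in> catalan_stanley"
  shows "reduction \<tau> \<in> catalan_stanley"
proof -
  have "even (rightmost_depth (cut_at_grandparent c))"
    if "c \<in> set (children \<tau>)" "c \<noteq> Node []" for c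
  proof -
    have e: "even (rightmost_depth c)" using assms that by (auto simp: catalan_stanley_def)
    obtain ts where c: "c = Node ts" by (cases c)
    with that have "rightmost_depth c \<noteq> 0" by simp
    with e have "2 \<le> rightmost_depth c" by presburger
    with e show ?thesis by (simp add: rightmost_depth_cut_at_grandparent)
  qed
  then show ?thesis by (auto simp: catalan_stanley_def reduction_def)
qed

lemma one_minus_fps_X_inverse:
  "(f / (1 - fps_X)) * (1 - fps_X) = (f :: real fps fps)"
proof -
  have "inverse (1 - fps_X :: real fps fps) * (1 - fps_X) = 1"
    unfolding fps_inverse_def[of "1 - fps_X :: real fps fps"]
    by (subst mult.commute, rule fps_right_inverse) simp
  then show ?thesis by (simp add: fps_divide_unit mult.assoc)
qed

end

theory Submission
  imports Defs
begin

text \<open>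
  Undoing one cut at the rightmost leaf of a branch means replacing that leaf by a node whose last
  child has a leaf as its last child. The remaining children of these two nodes form two arbitrary
  plane trees, so every branch contributes a factor \<open>T\<^sup>2\<close>. The deleted leaves may be put back
  anywhere among the branches: a tree with \<open>b\<close> branches has \<open>m choose b\<close> arrangements with \<open>m\<close>
  children of the root, and \<open>m choose b\<close> is the coefficient of \<open>t\<^sup>m\<close> in \<open>1/(1-t) (t/(1-t))\<^sup>b\<close>.
\<close>

unbundle fps_syntax

section \<open>Counting series of weighted sets\<close>

definition weight_gf :: "('a \<Rightarrow> nat) \<Rightarrow> 'a set \<Rightarrow> real fps" where
  "weight_gf w A = Abs_fps (\<lambda>n. of_nat (card {x \<in> A. w x = n}))"

text \<open>Since \<open>card\<close> of an infinite set is 0, the sum and product rules for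
  counting series are only sound where each weight is attained finitely often.\<close>

definition finite_fibres :: "('a \<Rightarrow> nat) \<Rightarrow> 'a set \<Rightarrow> bool" where
  "finite_fibres w A \<longleftrightarrow> (\<forall>n. finite {x \<in> A. w x = n})"

lemma finite_fibres_subset:
  assumes "finite_fibres w B" "A \<subseteq> B"
  shows "finite_fibres w A"
  unfolding finite_fibres_def
proof
  fix n
  have "finite {x \<in> B. w x = n}" using assms(1) by (simp add: finite_fibres_def)
  then show "finite {x \<in> A. w x = n}" by (rule rev_finite_subset) (use assms(2) in auto)
qed

lemma weight_gf_nth [simp]: "weight_gf w A $ n = of_nat (card {x \<in> A. w x = n})"
  by (simp add: weight_gf_def)

lemma weight_gf_Un:
  assumes "finite_fibres w A" "finite_fibres w B" "A \<inter> B = {}"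
  shows "weight_gf w (A \<union> B) = weight_gf w A + weight_gf w B"
proof (rule fps_ext)
  fix n
  have "{x \<in> A \<union> B. w x = n} = {x \<in> A. w x = n} \<union> {x \<in> B. w x = n}" by auto
  then show "weight_gf w (A \<union> B) $ n = (weight_gf w A + weight_gf w B) $ n"
    using assms by (simp add: finite_fibres_def card_Un_disjoint disjoint_iff)
qed

lemma weight_gf_shift:
  assumes "inj_on f A" "\<And>x. x \<in> A \<Longrightarrow> w (f x) = u x + k"
  shows "weight_gf w (f ` A) = fps_X ^ k * weight_gf u A"
proof (rule fps_ext)
  fix n
  have eq: "{x \<in> f ` A. w x = n} = f ` {x \<in> A. u x + k = n}" using assms(2) by auto
  have "card {x \<in> f ` A. w x = n} = card {x \<in> A. u x + k = n}"
    unfolding eq by (rule card_image) (rule inj_on_subset[OF assms(1)], auto)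
  moreover have "{x \<in> A. u x + k = n} = (if n < k then {} else {x \<in> A. u x = n - k})" by auto
  ultimately show "weight_gf w (f ` A) $ n = (fps_X ^ k * weight_gf u A) $ n"
    by (simp add: fps_X_power_mult_nth)
qed

lemma weight_gf_times:
  assumes "inj_on f (A \<times> B)" "\<And>a b. a \<in> A \<Longrightarrow> b \<in> B \<Longrightarrow> w (f (a, b)) = u a + v b"
    and "finite_fibres u A" "finite_fibres v B"
  shows "weight_gf w (f ` (A \<times> B)) = weight_gf u A * weight_gf v B"
proof (rule fps_ext)
  fix n
  \<comment> \<open>The pairs of total weight \<open>n\<close>, sorted by the weight
    \<open>i\<close> of the first component; the pieces are disjoint and give the terms of the
    Cauchy product.\<close>
  let ?C = "\<lambda>i. {a \<in> A. u a = i} \<times> {b \<in> B. v b = n - i}"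
  have eq: "{x \<in> f ` (A \<times> B). w x = n} = f ` (\<Union>i\<in>{0..n}. ?C i)"
    using assms(2) by (auto intro!: imageI)
  have "card {x \<in> f ` (A \<times> B). w x = n} = card (\<Union>i\<in>{0..n}. ?C i)"
    unfolding eq by (rule card_image) (rule inj_on_subset[OF assms(1)], auto)
  also have "\<dots> = (\<Sum>i=0..n. card (?C i))"
    using assms(3,4) by (intro card_UN_disjoint) (auto simp: finite_fibres_def)
  finally show "weight_gf w (f ` (A \<times> B)) $ n = (weight_gf u A * weight_gf v B) $ n"
    by (simp add: fps_mult_nth card_cartesian_product)
qed

section \<open>Plane trees\<close>

lemma plane_tree_gf_eq_weight_gf: "plane_tree_gf = weight_gf num_nodes UNIV"
  by (simp add: plane_tree_gf_def weight_gf_def)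

lemma finite_fibres_num_nodes: "finite_fibres num_nodes A"
  unfolding finite_fibres_def by (auto intro: finite_subset[OF _ finite_num_nodes_eq])

text \<open>Cutting the edge from the root to its first child splits a tree other than a leaf into
  an arbitrary pair of trees. The second one keeps the root, so the node counts add up without a
  shift.\<close>

lemma plane_tree_gf_equation: "plane_tree_gf = fps_X + plane_tree_gf\<^sup>2"
proof -
  let ?f = "\<lambda>(c, t). Node (c # children t)"
  have inj: "inj ?f"
    by (rule injI) (auto simp: plane_tree.expand)
  have img: "UNIV = {Node []} \<union> ?f ` (UNIV \<times> UNIV)"
  proof -
    have "\<tau> = Node [] \<or> \<tau> \<in> range ?f" for \<tau>
    proof (cases \<tau>)
      case (Node ts)
      show ?thesis
      proof (cases ts)
        case (Cons c cs)
        then have "\<tau> = ?f (c, Node cs)" using Node by simp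
        then show ?thesis by blast
      qed (use Node in simp)
    qed
    then show ?thesis by auto
  qed
  have "weight_gf num_nodes UNIV
      = weight_gf num_nodes {Node []} + weight_gf num_nodes (?f ` (UNIV \<times> UNIV))"
    by (subst img, rule weight_gf_Un) (auto simp: finite_fibres_num_nodes)
  also have "weight_gf num_nodes (?f ` (UNIV \<times> UNIV))
      = weight_gf num_nodes UNIV * weight_gf num_nodes UNIV"
  proof (rule weight_gf_times)
    fix c t :: plane_tree
    show "num_nodes (?f (c, t)) = num_nodes c + num_nodes t" by (cases t) simp
  qed (use inj in \<open>auto simp: finite_fibres_num_nodes\<close>)
  also have "weight_gf num_nodes {Node []} = fps_X"
  proof (rule fps_ext)
    fix n
    have "{x \<in> {Node []}. num_nodes x = n} = (if n = 1 then {Node []} else {})" by auto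
    then show "weight_gf num_nodes {Node []} $ n = fps_X $ n" by simp
  qed
  finally show ?thesis by (simp add: plane_tree_gf_eq_weight_gf power2_eq_square)
qed

lemma plane_tree_gf_closed_form:
  "plane_tree_gf = (1 - fps_radical root 2 (1 - 4 * fps_X)) / 2"
proof -
  let ?T = plane_tree_gf
  have "{\<tau>. num_nodes \<tau> = 0} = {}"
    using num_nodes_pos by (auto simp del: neq0_conv simp: neq0_conv[symmetric])
  then have T0: "?T $ 0 = 0"
    by (simp only: plane_tree_gf_def fps_nth_Abs_fps card.empty of_nat_0)
  have "(1 - 2 * ?T)\<^sup>2 = 1 - 4 * (?T - ?T\<^sup>2)"
    by (simp add: power2_eq_square algebra_simps)
  also have "?T - ?T\<^sup>2 = fps_X"
    using plane_tree_gf_equation by (simp add: algebra_simps)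
  finally have sq: "(1 - 2 * ?T) ^ Suc 1 = 1 - 4 * fps_X" by (simp add: numeral_2_eq_2)
  \<comment> \<open>The square root is unique once its constant coefficient is fixed.
    \<open>T0\<close> makes that coefficient 1, which selects the minus sign in the quadratic
    formula.\<close>
  have "1 - 2 * ?T = fps_radical root (Suc 1) (1 - 4 * fps_X)"
    by (rule iffD1[OF radical_unique]) (use sq T0 in auto)
  then have "fps_radical root 2 (1 - 4 * fps_X) = 1 - 2 * ?T" by (simp add: numeral_2_eq_2)
  then show ?thesis by simp
qed

section \<open>Inverting the cut\<close>

text \<open>The roots of \<open>x\<close> and \<open>y\<close> become the two new inner nodes of the
  rightmost path, and the new leaf stands for the old one. Hence exactly the nodes of
  \<open>x\<close> and \<open>y\<close> are added.\<close>

function graft_rightmost :: "plane_tree \<Rightarrow> plane_tree \<Rightarrow> plane_tree \<Rightarrow> plane_tree" where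
  "graft_rightmost x y (Node cs) =
     (if cs = [] then Node (children x @ [Node (children y @ [Node []])])
      else Node (butlast cs @ [graft_rightmost x y (last cs)]))"
  by pat_completeness auto
termination by (relation "measure (\<lambda>(x, y, c). rightmost_depth c)") auto

lemma num_nodes_graft_rightmost:
  "num_nodes (graft_rightmost x y c) = num_nodes c + num_nodes x + num_nodes y"
proof (induction x y c rule: graft_rightmost.induct)
  case (1 x y cs)
  show ?case
  proof (cases "cs = []")
    case True
    then show ?thesis by (cases x; cases y) simp
  next
    case False
    then obtain bs b where "cs = bs @ [b]" by (metis append_butlast_last_id)
    then show ?thesis using 1 by simp
  qed
qed

lemma graft_rightmost_inject:
  "graft_rightmost x y c = graft_rightmost x' y' c \<Longrightarrow> x = x' \<and> y = y'"
proof (induction x y c rule: graft_rightmost.induct)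
  case (1 x y cs)
  then show ?case by (cases "cs = []") (auto simp: plane_tree.expand)
qed

lemma rightmost_depth_graft_rightmost:
  "rightmost_depth (graft_rightmost x y c) = rightmost_depth c + 2"
  by (induction x y c rule: graft_rightmost.induct) auto

text \<open>Both recursions descend the rightmost path in step. Grafting raises the depth by 2, so
  the cut stops exactly where \<open>c\<close> has its rightmost leaf and restores it.\<close>

lemma cut_at_grandparent_graft_rightmost:
  "cut_at_grandparent (graft_rightmost x y c) = c"
proof (induction x y c rule: graft_rightmost.induct)
  case (1 x y cs)
  then show ?case
    by (cases "cs = []") (auto simp: rightmost_depth_graft_rightmost)
qed

lemma graft_rightmost_surj:
  "2 \<le> rightmost_depth d \<Longrightarrow> \<exists>x y. d = graft_rightmost x y (cut_at_grandparent d)"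
proof (induction d rule: cut_at_grandparent.induct)
  case (1 ts)
  have ts: "ts \<noteq> []" using 1(2) by auto
  show ?case
  proof (cases "rightmost_depth (Node ts) = 2")
    case True
    \<comment> \<open>Depth 2 forces the shape: the last child of the root has a leaf as its last
      child. The witnesses collect the other children of these two nodes.\<close>
    obtain us where us: "last ts = Node us" by (cases "last ts")
    with True ts have "us \<noteq> []" "rightmost_depth (last us) = 0" by (auto split: if_splits)
    moreover from this have "last us = Node []" by (cases "last us") (auto split: if_splits)
    ultimately have "us = butlast us @ [Node []]" by (metis append_butlast_last_id)
    with us ts have "ts = butlast ts @ [Node (butlast us @ [Node []])]"
      by (metis append_butlast_last_id)
    with True have "Node ts = graft_rightmost (Node (butlast ts)) (Node (butlast us))
        (cut_at_grandparent (Node ts))"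
      by simp
    then show ?thesis by blast
  next
    case False
    \<comment> \<open>The depth is now at least 3, so the grandparent lies in the last subtree and
      the induction hypothesis applies there.\<close>
    then have "2 \<le> rightmost_depth (last ts)" using 1(2) ts by simp
    then obtain x y where "last ts = graft_rightmost x y (cut_at_grandparent (last ts))"
      using 1 False by force
    then have "Node ts = graft_rightmost x y (cut_at_grandparent (Node ts))"
      using False 1(2) ts by (metis append_butlast_last_id append_is_Nil_conv butlast_snoc
          cut_at_grandparent.simps graft_rightmost.simps last_snoc linorder_not_less not_Cons_self2)
    then show ?thesis by blast
  qed
qed

text \<open>The depth bound matters because \<open>cut_at_grandparent\<close> fixes trees of smaller
  depth. In particular it excludes the single leaf, which the reduction deletes instead of
  cutting.\<close>

definition cut_preimage :: "plane_tree \<Rightarrow> plane_tree set" where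
  "cut_preimage c = {d. 2 \<le> rightmost_depth d \<and> cut_at_grandparent d = c}"

lemma cut_preimage_eq_range:
  "cut_preimage c = (\<lambda>(x, y). graft_rightmost x y c) ` (UNIV \<times> UNIV)"
proof
  show "cut_preimage c \<subseteq> (\<lambda>(x, y). graft_rightmost x y c) ` (UNIV \<times> UNIV)"
    using graft_rightmost_surj by (fastforce simp: cut_preimage_def)
qed (auto simp: cut_preimage_def rightmost_depth_graft_rightmost cut_at_grandparent_graft_rightmost)

text \<open>Subtracting 1 leaves out the rightmost leaf of the branch, which is marked by t and not
  by z. Grafting is a bijection from pairs of trees onto the preimage, so the choice of the pair
  gives the square of T.\<close>

lemma weight_gf_cut_preimage:
  "weight_gf (\<lambda>d. num_nodes d - 1) (cut_preimage c) = fps_X ^ (num_nodes c - 1) * plane_tree_gf\<^sup>2"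
proof -
  have "weight_gf (\<lambda>d. num_nodes d - 1) (cut_preimage c)
      = fps_X ^ (num_nodes c - 1) * weight_gf (\<lambda>(x, y). num_nodes x + num_nodes y) (UNIV \<times> UNIV)"
    unfolding cut_preimage_eq_range
  proof (rule weight_gf_shift)
    show "inj_on (\<lambda>(x, y). graft_rightmost x y c) (UNIV \<times> UNIV)"
      by (rule inj_onI) (auto dest: graft_rightmost_inject)
  qed (use num_nodes_pos[of c] in \<open>auto simp: num_nodes_graft_rightmost\<close>)
  also have "weight_gf (\<lambda>(x, y). num_nodes x + num_nodes y) (UNIV \<times> UNIV) = plane_tree_gf\<^sup>2"
    using weight_gf_times[where f = id and A = UNIV and B = UNIV and u = num_nodes and v = num_nodes
        and w = "\<lambda>(x, y). num_nodes x + num_nodes y"]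
    by (simp add: finite_fibres_num_nodes plane_tree_gf_eq_weight_gf power2_eq_square)
  finally show ?thesis .
qed

section \<open>Inverting the reduction\<close>

text \<open>Each branch is counted without its rightmost leaf. The root is left out as well, which
  makes the weight additive along the list.\<close>

definition branches_weight :: "plane_tree list \<Rightarrow> nat" where
  "branches_weight ts = (\<Sum>c\<leftarrow>ts. num_nodes c - 1)"

text \<open>Parity is replaced by the dichotomy leaf or depth at least 2. The recursion over the
  list then works for arbitrary \<open>cs\<close>, and parity is recovered later from the reduced
  tree.\<close>

definition branches_preimage :: "plane_tree list \<Rightarrow> nat \<Rightarrow> plane_tree list set" where
  "branches_preimage cs m = {ts. length ts = m \<and> (\<forall>d\<in>set ts. d = Node [] \<or> 2 \<le> rightmost_depth d)
     \<and> map cut_at_grandparent (filter (\<lambda>d. d \<noteq> Node []) ts) = cs}"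

lemma num_other_nodes_Node: "num_other_nodes (Node ts) = Suc (branches_weight ts)"
proof -
  have "(\<Sum>c\<leftarrow>ts. num_nodes c) = branches_weight ts + length ts"
  proof (induction ts)
    case (Cons c ts)
    then show ?case using num_nodes_pos[of c] by (simp add: branches_weight_def)
  qed (simp add: branches_weight_def)
  then show ?thesis by (simp add: num_other_nodes_def num_rightmost_leaves_def)
qed

lemma finite_fibres_num_nodes_minus_1: "finite_fibres (\<lambda>d. num_nodes d - 1) A"
  unfolding finite_fibres_def
proof
  fix n
  show "finite {x \<in> A. num_nodes x - 1 = n}"
    by (rule finite_subset[OF _ finite_num_nodes_le[of "Suc n"]]) auto
qed

lemma finite_fibres_branches_preimage: "finite_fibres branches_weight (branches_preimage cs m)"
  unfolding finite_fibres_def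
proof
  fix n
  have "Node ` {ts \<in> branches_preimage cs m. branches_weight ts = n}
      \<subseteq> {\<tau> \<in> UNIV. num_other_nodes \<tau> = Suc n \<and> num_rightmost_leaves \<tau> = m}"
    by (auto simp: num_other_nodes_Node num_rightmost_leaves_def branches_preimage_def)
  then have "finite (Node ` {ts \<in> branches_preimage cs m. branches_weight ts = n})"
    by (rule finite_subset) (rule finite_bivariate_class)
  then show "finite {ts \<in> branches_preimage cs m. branches_weight ts = n}"
    by (rule finite_imageD) (auto intro: inj_onI)
qed

lemma branches_preimage_0: "branches_preimage cs 0 = (if cs = [] then {[]} else {})"
  by (auto simp: branches_preimage_def)

lemma branches_preimage_Nil_Suc:
  "branches_preimage [] (Suc m) = (#) (Node []) ` branches_preimage [] m"
proof -
  have "ts \<in> branches_preimage [] (Suc m) \<longleftrightarrow> ts \<in> (#) (Node []) ` branches_preimage [] m" for ts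
    by (cases ts) (auto simp: branches_preimage_def)
  then show ?thesis by blast
qed

text \<open>The first branch is either a leaf put back by undoing the deletion or a regrown version
  of \<open>c\<close>. These are the two cases of Pascal's rule.\<close>

lemma branches_preimage_Cons_Suc:
  "branches_preimage (c # cs) (Suc m) = (#) (Node []) ` branches_preimage (c # cs) m
     \<union> (\<lambda>(d, ts). d # ts) ` (cut_preimage c \<times> branches_preimage cs m)"
proof -
  have "ts \<in> branches_preimage (c # cs) (Suc m) \<longleftrightarrow>
      ts \<in> (#) (Node []) ` branches_preimage (c # cs) m
        \<union> (\<lambda>(d, ts). d # ts) ` (cut_preimage c \<times> branches_preimage cs m)" for ts
  proof (cases ts)
    case (Cons d ts')
    then show ?thesis
      by (cases "d = Node []") (auto simp: branches_preimage_def cut_preimage_def)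
  qed (auto simp: branches_preimage_def)
  then show ?thesis by blast
qed

lemma weight_gf_Cons_leaf:
  "weight_gf branches_weight ((#) (Node []) ` A) = weight_gf branches_weight A"
  using weight_gf_shift[of "(#) (Node [])" A branches_weight branches_weight 0]
  by (simp add: branches_weight_def)

text \<open>The binomial coefficient chooses the positions of the regrown branches among the
  \<open>m\<close> children, each contributing the square of T; the other positions hold leaves of
  weight 0. The induction on \<open>m\<close> adds the binomials by Pascal's rule.\<close>

lemma weight_gf_branches_preimage:
  "weight_gf branches_weight (branches_preimage cs m)
     = of_nat (m choose length cs) * fps_X ^ branches_weight cs * plane_tree_gf ^ (2 * length cs)"
proof (induction m arbitrary: cs)
  case 0
  have "{x. x = [] \<and> branches_weight x = n} = (if n = 0 then {[]} else {})" for n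
    by (auto simp: branches_weight_def)
  then have "weight_gf branches_weight {[]} = 1"
    by (intro fps_ext) simp
  moreover have "weight_gf branches_weight {} = 0"
    by (intro fps_ext) simp
  ultimately show ?case
    by (cases cs) (simp_all add: branches_preimage_0 branches_weight_def[of "[]"])
next
  case (Suc m)
  show ?case
  proof (cases cs)
    case Nil
    then show ?thesis
      using Suc.IH[of "[]"] by (simp add: branches_preimage_Nil_Suc weight_gf_Cons_leaf)
  next
    case (Cons c cs')
    let ?A = "(#) (Node []) ` branches_preimage (c # cs') m"
    let ?B = "(\<lambda>(d, ts). d # ts) ` (cut_preimage c \<times> branches_preimage cs' m)"
    have fin: "finite_fibres branches_weight ?A" "finite_fibres branches_weight ?B"
      using finite_fibres_branches_preimage[of "c # cs'" "Suc m"]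
      unfolding branches_preimage_Cons_Suc
      by (rule finite_fibres_subset, blast)+
    \<comment> \<open>The heads differ: \<open>cut_preimage c\<close> contains no leaf.\<close>
    have "?A \<inter> ?B = {}" by (auto simp: cut_preimage_def)
    then have "weight_gf branches_weight (branches_preimage cs (Suc m))
        = weight_gf branches_weight ?A + weight_gf branches_weight ?B"
      unfolding Cons branches_preimage_Cons_Suc by (rule weight_gf_Un[OF fin])
    also have "weight_gf branches_weight ?B
        = fps_X ^ (num_nodes c - 1) * plane_tree_gf\<^sup>2 * weight_gf branches_weight (branches_preimage cs' m)"
      unfolding weight_gf_cut_preimage[symmetric]
      by (rule weight_gf_times[OF _ _ finite_fibres_num_nodes_minus_1 finite_fibres_branches_preimage])
        (auto intro: inj_onI simp: branches_weight_def)
    finally show ?thesis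
      unfolding weight_gf_Cons_leaf Suc.IH Cons
      by (simp add: branches_weight_def power_add algebra_simps power2_eq_square)
  qed
qed

text \<open>An even depth is 0 or at least 2, which gives one direction. For the other, cutting
  lowers the depth by exactly 2, so a branch inherits its parity from the corresponding branch in
  \<open>cs\<close>.\<close>

lemma reduction_eq_iff_branches_preimage:
  assumes "Node cs \<in> catalan_stanley"
  shows "Node ts \<in> catalan_stanley \<and> reduction (Node ts) = Node cs
    \<longleftrightarrow> ts \<in> branches_preimage cs (length ts)"
proof
  assume *: "Node ts \<in> catalan_stanley \<and> reduction (Node ts) = Node cs"
  have "d = Node [] \<or> 2 \<le> rightmost_depth d" if "d \<in> set ts" for d
  proof -
    have "even (rightmost_depth d)" using * that by (auto simp: catalan_stanley_def)
    moreover have "d = Node [] \<or> rightmost_depth d \<noteq> 0" by (cases d) auto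
    ultimately show ?thesis by (auto elim: evenE)
  qed
  with * show "ts \<in> branches_preimage cs (length ts)"
    by (auto simp: branches_preimage_def reduction_def)
next
  assume *: "ts \<in> branches_preimage cs (length ts)"
  have "even (rightmost_depth d)" if d: "d \<in> set ts" for d
  proof (cases "d = Node []")
    case False
    then have ge: "2 \<le> rightmost_depth d" using * d by (auto simp: branches_preimage_def)
    have "cut_at_grandparent d \<in> set cs" using * d False by (auto simp: branches_preimage_def)
    then have "even (rightmost_depth (cut_at_grandparent d))"
      using assms by (auto simp: catalan_stanley_def)
    then show ?thesis using ge by (simp add: rightmost_depth_cut_at_grandparent)
  qed simp
  with * show "Node ts \<in> catalan_stanley \<and> reduction (Node ts) = Node cs"
    by (auto simp: branches_preimage_def reduction_def catalan_stanley_def)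
qed

text \<open>The difference \<open>a - num_other_nodes \<sigma>\<close> is the number of nodes gained
  by grafting. The case distinction guards this truncated subtraction: the reduction never increases
  the number of other nodes.\<close>

lemma card_reduction_fibre:
  assumes "\<sigma> \<in> catalan_stanley"
  shows "of_nat (card {\<tau> \<in> catalan_stanley. reduction \<tau> = \<sigma> \<and> num_other_nodes \<tau> = a
      \<and> num_rightmost_leaves \<tau> = m})
    = (if num_other_nodes \<sigma> \<le> a then of_nat (m choose num_rightmost_leaves \<sigma>)
         * (plane_tree_gf ^ (2 * num_rightmost_leaves \<sigma>)) $ (a - num_other_nodes \<sigma>) else (0 :: real))"
proof -
  obtain cs where \<sigma>: "\<sigma> = Node cs" by (cases \<sigma>)
  let ?A = "{ts \<in> branches_preimage cs m. Suc (branches_weight ts) = a}"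
  have "{\<tau> \<in> catalan_stanley. reduction \<tau> = \<sigma> \<and> num_other_nodes \<tau> = a \<and> num_rightmost_leaves \<tau> = m}
      = Node ` ?A"
  proof -
    have "\<tau> \<in> catalan_stanley \<and> reduction \<tau> = \<sigma> \<and> num_other_nodes \<tau> = a \<and> num_rightmost_leaves \<tau> = m
        \<longleftrightarrow> \<tau> \<in> Node ` ?A" for \<tau>
    proof (cases \<tau>)
      case (Node ts)
      have "length ts = m" if "ts \<in> branches_preimage cs m"
        using that by (simp add: branches_preimage_def)
      then show ?thesis
        using reduction_eq_iff_branches_preimage[of cs ts] assms
        by (auto simp: Node \<sigma> num_other_nodes_Node num_rightmost_leaves_def)
    qed
    then show ?thesis by blast
  qed
  then have card: "card {\<tau> \<in> catalan_stanley. reduction \<tau> = \<sigma> \<and> num_other_nodes \<tau> = a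
      \<and> num_rightmost_leaves \<tau> = m} = card ?A"
    by (simp add: card_image inj_on_def)
  show ?thesis
  \<comment> \<open>The root is one of the other nodes, so the branches have weight
    \<open>a - 1\<close>; for \<open>a = 0\<close> both sides vanish.\<close>
  proof (cases a)
    case 0
    then show ?thesis unfolding card by (simp add: \<sigma> num_other_nodes_Node)
  next
    case (Suc k)
    have "real (card ?A) = weight_gf branches_weight (branches_preimage cs m) $ k"
      by (simp add: Suc)
    also have "\<dots> = (fps_const (of_nat (m choose length cs)) * (fps_X ^ branches_weight cs
        * plane_tree_gf ^ (2 * length cs))) $ k"
      unfolding weight_gf_branches_preimage by (simp only: fps_of_nat mult.assoc)
    finally show ?thesis
      unfolding card fps_mult_left_const_nth fps_X_power_mult_nth
      by (simp add: \<sigma> Suc num_other_nodes_Node num_rightmost_leaves_def not_less)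
  qed
qed

section \<open>The expansion operator\<close>

lemma inverse_one_minus_fps_X_nth: "(1 / (1 - fps_X) * g :: real fps fps) $ m = (\<Sum>j=0..m. g $ j)"
proof -
  have "(1 / (1 - fps_X) :: real fps fps) = Abs_fps (\<lambda>_. 1)"
  proof -
    have "Abs_fps (\<lambda>_. 1) * (1 - fps_X) = (1 :: real fps fps)"
      by (rule fps_ext) (simp add: algebra_simps)
    \<comment> \<open>The coefficient ring is no field, so the quotient is identified by multiplying
      the geometric series with \<open>1 - fps_X\<close> and cancelling through
      \<open>one_minus_fps_X_inverse\<close>.\<close>
    then have "(1 / (1 - fps_X)) * (1 - fps_X) * Abs_fps (\<lambda>_. 1) = (1 / (1 - fps_X) :: real fps fps)"
      by (simp add: ac_simps)
    then show ?thesis by (simp only: one_minus_fps_X_inverse mult_1_left)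
  qed
  then have "(1 / (1 - fps_X) * g) $ m = (\<Sum>j=0..m. g $ (m - j))"
    by (simp only: fps_mult_nth fps_nth_Abs_fps mult_1_left)
  also have "\<dots> = (\<Sum>j=0..m. g $ j)"
    by (subst sum.atLeastAtMost_rev) simp
  finally show ?thesis .
qed

text \<open>Multiplying the series for \<open>Suc b\<close> by \<open>1 - fps_X\<close> gives
  \<open>fps_X\<close> times the series for \<open>b\<close>. Read coefficientwise, this is Pascal's
  rule.\<close>

lemma binomial_series_nth:
  "(1 / (1 - fps_X) * (fps_X / (1 - fps_X)) ^ b :: real fps fps) $ m = of_nat (m choose b)"
proof (induction b arbitrary: m)
  case 0
  show ?case by (simp add: inverse_one_minus_fps_X_nth[of 1, simplified])
next
  case (Suc b)
  note G = Suc.IH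
  let ?G = "1 / (1 - fps_X) * (fps_X / (1 - fps_X)) ^ b :: real fps fps"
  let ?H = "1 / (1 - fps_X) * (fps_X / (1 - fps_X)) ^ Suc b :: real fps fps"
  have "?H * (1 - fps_X) = ?G * ((fps_X / (1 - fps_X)) * (1 - fps_X))"
    by (simp only: power_Suc ac_simps)
  then have rec: "?H = fps_X * ?G + fps_X * ?H"
    unfolding one_minus_fps_X_inverse by (simp only: right_diff_distrib mult_1_right diff_eq_eq mult.commute[of _ fps_X])
  show ?case
  proof (induction m)
    case 0
    have "?H $ 0 = (fps_X * ?G + fps_X * ?H) $ 0" using rec by (rule arg_cong)
    then show ?case by simp
  next
    case (Suc m)
    have "?H $ Suc m = (fps_X * ?G + fps_X * ?H) $ Suc m" using rec by (rule arg_cong)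
    also have "\<dots> = ?G $ m + ?H $ m" by (simp only: fps_add_nth fps_X_mult_nth) simp
    also have "\<dots> = of_nat (Suc m choose Suc b)" unfolding Suc.IH G by simp
    finally show ?case .
  qed
qed

lemma expansion_nth:
  "expansion T f $ m = (\<Sum>b=0..m. f $ b * (of_nat (m choose b) * T ^ (2 * b)))"
proof -
  let ?g = "fps_X / (1 - fps_X) * fps_const (T\<^sup>2) :: real fps fps"
  have g0: "?g $ 0 = 0"
    by (simp add: fps_divide_unit)
  have "expansion T f $ m = (\<Sum>j=0..m. \<Sum>b=0..j. f $ b * (?g ^ b) $ j)"
    unfolding expansion_def inverse_one_minus_fps_X_nth by (simp add: fps_compose_nth)
  \<comment> \<open>The power \<open>?g ^ b\<close> starts at degree \<open>b\<close> or later, so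
    the added terms with \<open>b > j\<close> are 0. The ranges are now independent and the sums can
    be swapped.\<close>
  also have "\<dots> = (\<Sum>j=0..m. \<Sum>b=0..m. f $ b * (?g ^ b) $ j)"
    by (intro sum.cong[OF refl] sum.mono_neutral_left)
      (auto simp: startsby_zero_power_prefix[OF g0])
  also have "\<dots> = (\<Sum>b=0..m. f $ b * (\<Sum>j=0..m. (?g ^ b) $ j))"
    by (subst sum.swap) (simp add: sum_distrib_left)
  also have "\<dots> = (\<Sum>b=0..m. f $ b * (of_nat (m choose b) * T ^ (2 * b)))"
  proof (intro sum.cong refl arg_cong2[where f = "(*)"])
    fix b
    \<comment> \<open>The partial sum is read back as multiplication by the prefactor 1/(1-t), which
      completes the binomial series.\<close>
    have "(\<Sum>j=0..m. (?g ^ b) $ j) = (1 / (1 - fps_X) * ?g ^ b) $ m"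
      by (rule inverse_one_minus_fps_X_nth[symmetric])
    also have "1 / (1 - fps_X) * ?g ^ b
        = (1 / (1 - fps_X) * (fps_X / (1 - fps_X)) ^ b) * fps_const (T ^ (2 * b))"
      by (simp only: power_mult_distrib fps_const_power power_mult mult.assoc)
    finally show "(\<Sum>j=0..m. (?g ^ b) $ j) = of_nat (m choose b) * T ^ (2 * b)"
      by (simp only: fps_mult_right_const_nth binomial_series_nth)
  qed
  finally show ?thesis .
qed

section \<open>Summation over the fibres of the reduction\<close>

theorem mainTheorem2:
  fixes F :: "plane_tree set"
  assumes "F \<subseteq> catalan_stanley"
  shows "bivariate_gf {\<tau> \<in> catalan_stanley. reduction \<tau> \<in> F}
           = expansion plane_tree_gf (bivariate_gf F)
         \<and> plane_tree_gf = (1 - fps_radical root 2 (1 - 4 * fps_X)) / 2"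
proof (intro conjI plane_tree_gf_closed_form fps_ext)
  fix m a
  let ?other = num_other_nodes and ?leaves = num_rightmost_leaves
  define fibre where "fibre \<sigma> = {\<tau> \<in> catalan_stanley. reduction \<tau> = \<sigma> \<and> ?other \<tau> = a \<and> ?leaves \<tau> = m}"
    for \<sigma>
  define G where "G i b = {\<sigma> \<in> F. ?other \<sigma> = i \<and> ?leaves \<sigma> = b}" for i b
  \<comment> \<open>For \<open>i\<close> at most \<open>a\<close>, the size of the fibre over any
    tree of \<open>F\<close> with \<open>i\<close> other nodes and \<open>b\<close> rightmost
    leaves; it depends on the tree only through these two numbers.\<close>
  define c where "c i b = real (m choose b) * (plane_tree_gf ^ (2 * b)) $ (a - i)" for i b
  have fin: "finite (fibre \<sigma>)" for \<sigma>
    using finite_bivariate_class[of "{\<tau> \<in> catalan_stanley. reduction \<tau> = \<sigma>}" a m]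
    by (simp add: fibre_def)
  have finG: "finite (G i b)" for i b
    unfolding G_def by (rule finite_bivariate_class)
  have card_fibre: "real (card (fibre \<sigma>)) = (if ?other \<sigma> \<le> a then c (?other \<sigma>) (?leaves \<sigma>) else 0)"
    if "\<sigma> \<in> F" for \<sigma>
    using card_reduction_fibre[of \<sigma> a m] that assms by (auto simp: fibre_def c_def)
  \<comment> \<open>\<open>F\<close> may be infinite, but only finitely many of its trees have a
    nonempty fibre: the binomial coefficient vanishes for more than \<open>m\<close> leaves. This
    bounds the index set \<open>?I\<close>.\<close>
  have bound: "?other \<sigma> \<le> a \<and> ?leaves \<sigma> \<le> m" if "\<sigma> \<in> F" "fibre \<sigma> \<noteq> {}" for \<sigma>
  proof -
    have "real (card (fibre \<sigma>)) \<noteq> 0" using fin that by simp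
    then show ?thesis using card_fibre[OF that(1)]
      by (auto simp: c_def split: if_splits intro: ccontr)
  qed
  let ?I = "{0..m} \<times> {0..a}"
  have "{\<tau> \<in> {\<tau> \<in> catalan_stanley. reduction \<tau> \<in> F}. ?other \<tau> = a \<and> ?leaves \<tau> = m}
      = (\<Union>\<sigma>\<in>F. fibre \<sigma>)"
    by (auto simp: fibre_def)
  also have "\<dots> = (\<Union>\<sigma>\<in>(\<Union>(b, i)\<in>?I. G i b). fibre \<sigma>)"
    using bound by (fastforce simp: G_def)
  finally have "bivariate_gf {\<tau> \<in> catalan_stanley. reduction \<tau> \<in> F} $ m $ a
      = real (card (\<Union>\<sigma>\<in>(\<Union>(b, i)\<in>?I. G i b). fibre \<sigma>))"
    by (simp add: bivariate_gf_def)
  also have "\<dots> = (\<Sum>\<sigma>\<in>(\<Union>(b, i)\<in>?I. G i b). real (card (fibre \<sigma>)))"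
    by (subst card_UN_disjoint) (auto simp: fin finG, auto simp: fibre_def)
  \<comment> \<open>Trees of \<open>F\<close> are grouped by their two statistics, on which the
    fibre size is constant.\<close>
  also have "\<dots> = (\<Sum>(b, i)\<in>?I. \<Sum>\<sigma>\<in>G i b. real (card (fibre \<sigma>)))"
    by (subst sum.UNION_disjoint) (auto simp: finG case_prod_unfold, auto simp: G_def)
  also have "\<dots> = (\<Sum>(b, i)\<in>?I. real (card (G i b)) * c i b)"
  proof (intro sum.cong refl, clarify)
    fix b i assume "b \<in> {0..m}" "i \<in> {0..a}"
    then have "(\<Sum>\<sigma>\<in>G i b. real (card (fibre \<sigma>))) = (\<Sum>\<sigma>\<in>G i b. c i b)"
      by (intro sum.cong refl) (auto simp: G_def card_fibre)
    then show "(\<Sum>\<sigma>\<in>G i b. real (card (fibre \<sigma>))) = real (card (G i b)) * c i b" by simp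
  qed
  also have "\<dots> = (\<Sum>b=0..m. \<Sum>i=0..a. real (card (G i b)) * c i b)"
    by (simp add: sum.cartesian_product)
  also have "\<dots> = expansion plane_tree_gf (bivariate_gf F) $ m $ a"
  proof -
    \<comment> \<open>For fixed \<open>b\<close>, the sum over \<open>i\<close> is the Cauchy
      product in z of the series counting \<open>F\<close> with a power of T.\<close>
    have "(bivariate_gf F $ b * (of_nat (m choose b) * plane_tree_gf ^ (2 * b))) $ a
        = (\<Sum>i=0..a. real (card (G i b)) * c i b)" for b
      unfolding fps_of_nat[symmetric] fps_mult_nth[of "bivariate_gf F $ b"] fps_mult_left_const_nth
      by (simp add: bivariate_gf_def G_def c_def)
    then show ?thesis by (simp add: expansion_nth fps_sum_nth)
  qed
  finally show "bivariate_gf {\<tau> \<in> catalan_stanley. reduction \<tau> \<in> F} $ m $ a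
      = expansion plane_tree_gf (bivariate_gf F) $ m $ a" .
qed

end
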